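(* Let $X$ be a finite set with $|X|\ge 2$ and let $G$ be a countable group, with unit $e$, acting self-similarly on $X^\omega$. Assume that the action is contracting with nucleus $\mathcal N$. If for every $g\in\mathcal N$ there exists $u\in X^*$ such that $h(g,u)=e$, then $\mu\big(\bigcup_{n\in\mathbb N}Y_g^n\big)=1$ for every $g\in G$, where $Y_g^n:=\{w\in X^\omega : h(g,w^{(n)})=e\}$ and $w^{(n)}\in X^n$ denotes the first $n$ letters of $w$.
   Context: $X^*=\bigcup_{n\ge 0}X^n$ is the set of finite words over $X$ and $X^\omega\cong X^{\mathbb N}$ is the set of unilateral infinite words with the product topology. A faithful action of a group $G$ on $X^\omega$ is self-similar if for every $g\in G$, $x\in X$ there exist $h\in G$, $v\in X$ with $g(xw)=v\,h(w)$ for all $w\in X^\omega$. Then for all $n$, $g\in G$, $u\in X^n$ there are unique $h(g,u)\in G$ and $v(g,u)\in X^n$ with $g(uw)=v(g,u)\,h(g,u)(w)$ for all $w\in X^\omega$. The action is contracting if there is a finite set $\mathcal N\subset G$ such that for every $g\in G$ there exists $n\in\mathbb N$ with $h(g,v)\in\mathcal N$ for every $v\in X^*$ of length larger than $n$; the smallest finite set with this property is called the nucleus. $\mu$ is the Bernoulli measure on $X^\omega$, i.e. the product of the uniform probability measures on $X$. *)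

theory Defs
  imports "HOL-Probability.Stream_Space" "HOL-Algebra.Group_Action"
begin

text \<open>
  Infinite words over \<open>X\<close> are streams, so that \<open>X\<^sup>\<omega>\<close> is \<^term>\<open>streams X\<close>; finite words are lists,
  and \<open>u @- w\<close> is the concatenation of a finite and an infinite word. As usual for group actions
  in HOL-Algebra, \<open>\<phi> g\<close> is a function on all streams that is \<open>undefined\<close> outside \<open>X\<^sup>\<omega>\<close>.
\<close>

locale self_similar_action = faithful_action G "streams X" \<phi>
  for G (structure) and X :: "'x set" and \<phi> :: "'g \<Rightarrow> 'x stream \<Rightarrow> 'x stream" +
  assumes self_similar:
    "\<lbrakk>g \<in> carrier G; x \<in> X\<rbrakk> \<Longrightarrow>
       \<exists>h \<in> carrier G. \<exists>v \<in> X. \<forall>w \<in> streams X. \<phi> g (x ## w) = v ## \<phi> h w"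

definition is_decomp ::
  "('g, 'c) monoid_scheme \<Rightarrow> 'x set \<Rightarrow> ('g \<Rightarrow> 'x stream \<Rightarrow> 'x stream) \<Rightarrow>
     'g \<Rightarrow> 'x list \<Rightarrow> 'x list \<Rightarrow> 'g \<Rightarrow> bool" where
  "is_decomp G X \<phi> g u v h \<longleftrightarrow>
     h \<in> carrier G \<and> v \<in> lists X \<and> length v = length u \<and>
     (\<forall>w \<in> streams X. \<phi> g (u @- w) = v @- \<phi> h w)"

text \<open>
  The element \<open>h(g,u)\<close>. The description is meaningful for self-similar actions over a nonempty
  alphabet, see \<open>decomp_unique\<close> and \<open>is_decomp_section_at\<close> below.
\<close>

definition section_at ::
  "('g, 'c) monoid_scheme \<Rightarrow> 'x set \<Rightarrow> ('g \<Rightarrow> 'x stream \<Rightarrow> 'x stream) \<Rightarrow> 'g \<Rightarrow> 'x list \<Rightarrow> 'g" where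
  "section_at G X \<phi> g u = (THE h. \<exists>v. is_decomp G X \<phi> g u v h)"

definition contracting_set ::
  "('g, 'c) monoid_scheme \<Rightarrow> 'x set \<Rightarrow> ('g \<Rightarrow> 'x stream \<Rightarrow> 'x stream) \<Rightarrow> 'g set \<Rightarrow> bool" where
  "contracting_set G X \<phi> N \<longleftrightarrow>
     N \<subseteq> carrier G \<and> finite N \<and>
     (\<forall>g \<in> carrier G. \<exists>n. \<forall>v \<in> lists X. length v > n \<longrightarrow> section_at G X \<phi> g v \<in> N)"

definition contracting ::
  "('g, 'c) monoid_scheme \<Rightarrow> 'x set \<Rightarrow> ('g \<Rightarrow> 'x stream \<Rightarrow> 'x stream) \<Rightarrow> bool" where
  "contracting G X \<phi> \<longleftrightarrow> (\<exists>N. contracting_set G X \<phi> N)"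

text \<open>\<open>LEAST\<close> refers to the inclusion order on sets.\<close>

definition nucleus ::
  "('g, 'c) monoid_scheme \<Rightarrow> 'x set \<Rightarrow> ('g \<Rightarrow> 'x stream \<Rightarrow> 'x stream) \<Rightarrow> 'g set" where
  "nucleus G X \<phi> = (LEAST N. contracting_set G X \<phi> N)"

definition bernoulli_measure :: "'x set \<Rightarrow> 'x stream measure" where
  "bernoulli_measure X = stream_space (uniform_count_measure X)"

text \<open>The set \<open>Y\<^sub>g\<^sup>n\<close>.\<close>

definition trivial_section_set ::
  "('g, 'c) monoid_scheme \<Rightarrow> 'x set \<Rightarrow> ('g \<Rightarrow> 'x stream \<Rightarrow> 'x stream) \<Rightarrow> 'g \<Rightarrow> nat \<Rightarrow> 'x stream set" where
  "trivial_section_set G X \<phi> g n = {w \<in> streams X. section_at G X \<phi> g (stake n w) = \<one>\<^bsub>G\<^esub>}"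

context self_similar_action
begin

lemma decomp_exists:
  assumes "u \<in> lists X" "g \<in> carrier G"
  shows "\<exists>v h. is_decomp G X \<phi> g u v h"
  using assms
proof (induction u arbitrary: g rule: list.induct)
  case Nil
  then have "is_decomp G X \<phi> g [] [] g" by (simp add: is_decomp_def)
  then show ?case by blast
next
  case (Cons x u)
  then obtain h v where h: "h \<in> carrier G" "v \<in> X"
    and eq: "\<forall>w \<in> streams X. \<phi> g (x ## w) = v ## \<phi> h w"
    using self_similar[of g x] by auto
  obtain v' h' where "is_decomp G X \<phi> h u v' h'"
    using Cons.IH[of h] Cons.prems h by auto
  moreover have "u @- w \<in> streams X" if "w \<in> streams X" for w
    using Cons.prems that by (auto intro: shift_streams)
  ultimately have "is_decomp G X \<phi> g (x # u) (v # v') h'"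
    using h eq by (auto simp: is_decomp_def)
  then show ?case by blast
qed

lemma decomp_unique:
  assumes "X \<noteq> {}" and a: "is_decomp G X \<phi> g u v h" and b: "is_decomp G X \<phi> g u v' h'"
  shows "v = v' \<and> h = h'"
proof -
  have len: "length v = length v'" using a b by (simp add: is_decomp_def)
  have eq: "v = v' \<and> \<phi> h w = \<phi> h' w" if "w \<in> streams X" for w
  proof -
    have *: "v @- \<phi> h w = v' @- \<phi> h' w"
      using a b that by (simp add: is_decomp_def)
    have "v = v'"
      using arg_cong[OF *, of "stake (length v)"] len by (simp add: stake_shift)
    then show ?thesis using * by simp
  qed
  obtain x where "x \<in> X" using \<open>X \<noteq> {}\<close> by blast
  then have "sconst x \<in> streams X" by (simp add: streams_iff_sset)
  then have v: "v = v'" using eq by blast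
  have hc: "h \<in> carrier G" "h' \<in> carrier G" using a b by (auto simp: is_decomp_def)
  have "\<phi> k \<in> extensional (streams X)" if "k \<in> carrier G" for k
    using group_hom.hom_closed[OF group_hom that] by (simp add: BijGroup_def Bij_def)
  then have "\<phi> h = \<phi> h'"
    using eq hc extensionalityI[of "\<phi> h" "streams X" "\<phi> h'"] by blast
  then show ?thesis using v faithful hc by (auto dest: inj_onD)
qed

lemma is_decomp_section_at:
  assumes "X \<noteq> {}" "u \<in> lists X" "g \<in> carrier G"
  shows "\<exists>v. is_decomp G X \<phi> g u v (section_at G X \<phi> g u)"
proof -
  have "\<exists>!h. \<exists>v. is_decomp G X \<phi> g u v h"
    using decomp_exists[OF assms(2,3)] decomp_unique[OF assms(1)] by blast
  from theI'[OF this] show ?thesis by (simp add: section_at_def)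
qed

end

lemma contracting_set_Int:
  assumes "contracting_set G X \<phi> M" "contracting_set G X \<phi> N"
  shows "contracting_set G X \<phi> (M \<inter> N)"
  unfolding contracting_set_def
proof (intro conjI ballI)
  fix g assume "g \<in> carrier G"
  then obtain m n where
    "\<forall>v \<in> lists X. length v > m \<longrightarrow> section_at G X \<phi> g v \<in> M"
    "\<forall>v \<in> lists X. length v > n \<longrightarrow> section_at G X \<phi> g v \<in> N"
    using assms unfolding contracting_set_def by blast
  then have "\<forall>v \<in> lists X. length v > max m n \<longrightarrow> section_at G X \<phi> g v \<in> M \<inter> N"
    by auto
  then show "\<exists>n. \<forall>v \<in> lists X. length v > n \<longrightarrow> section_at G X \<phi> g v \<in> M \<inter> N"
    by blast
qed (use assms in \<open>auto simp: contracting_set_def\<close>)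

lemma nucleus_least:
  assumes "contracting G X \<phi>"
  shows "contracting_set G X \<phi> (nucleus G X \<phi>)"
    and "contracting_set G X \<phi> M \<Longrightarrow> nucleus G X \<phi> \<subseteq> M"
proof -
  let ?P = "contracting_set G X \<phi>"
  obtain N where N: "?P N" and min: "\<And>M. ?P M \<Longrightarrow> card N \<le> card M"
    using assms exists_least_iff[of "\<lambda>n. \<exists>N. ?P N \<and> card N = n"]
    unfolding contracting_def by (metis linorder_not_le)
  have least: "N \<subseteq> M" if "?P M" for M
  proof -
    have "card N \<le> card (N \<inter> M)" using min contracting_set_Int[OF N that] by blast
    moreover have "finite N" using N by (simp add: contracting_set_def)
    ultimately have "N \<inter> M = N" by (intro card_seteq) auto
    then show ?thesis by blast
  qed
  have "nucleus G X \<phi> = N"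
    unfolding nucleus_def using N least by (intro Least_equality) auto
  then show "?P (nucleus G X \<phi>)" and "?P M \<Longrightarrow> nucleus G X \<phi> \<subseteq> M"
    using N least by auto
qed

end

theory Submission
  imports Defs
begin

text \<open>
  The proof is a minimum principle. Let \<open>p(g)\<close> be the measure of the set \<open>\<Union>\<^sub>n Y\<^sub>g\<^sup>n\<close> of words along
  which some section of \<open>g\<close> becomes trivial. Splitting off the first letter of a word and using
  \<open>h(g, xu) = h(h(g, x), u)\<close> shows that \<open>p\<close> is harmonic: \<open>p(g)\<close> is the average of \<open>p(h(g, x))\<close> over
  the letters \<open>x\<close> (\<open>trivial_section_prob_average\<close>).

  By contraction, all sections of \<open>g\<close> at long words lie in the finite nucleus, so iterating the
  averaging shows that the minimum \<open>m\<close> of \<open>p\<close> over the nucleus is the minimum of \<open>p\<close> over the whole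
  group (\<open>trivial_section_prob_lower_bound\<close>). An average of numbers that are at least \<open>m\<close> equals \<open>m\<close>
  only if all of them do; so if \<open>g\<close> is an element of the nucleus at which the minimum is attained,
  then \<open>p(h(g, u)) = m\<close> for every finite word \<open>u\<close> (\<open>trivial_section_prob_minimum_spreads\<close>). By
  hypothesis \<open>h(g, u)\<close> is the unit for some \<open>u\<close>, and \<open>p(e) = 1\<close>. Hence \<open>m = 1\<close>, and \<open>p\<close> is
  constantly \<open>1\<close>.
\<close>

section \<open>Sections of group elements\<close>

context self_similar_action
begin

lemma section_at_eqI:
  assumes "X \<noteq> {}" "is_decomp G X \<phi> g u v h"
  shows "section_at G X \<phi> g u = h"
  unfolding section_at_def using assms decomp_unique[OF assms(1)] by blast

lemma section_at_closed:
  assumes "X \<noteq> {}" "u \<in> lists X" "g \<in> carrier G"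
  shows "section_at G X \<phi> g u \<in> carrier G"
  using is_decomp_section_at[OF assms] by (auto simp: is_decomp_def)

lemma section_at_Nil:
  assumes "X \<noteq> {}" "g \<in> carrier G"
  shows "section_at G X \<phi> g [] = g"
proof -
  have "is_decomp G X \<phi> g [] [] g" using assms by (simp add: is_decomp_def)
  then show ?thesis by (rule section_at_eqI[OF assms(1)])
qed

lemma section_at_append:
  assumes "X \<noteq> {}" "u \<in> lists X" "v \<in> lists X" "g \<in> carrier G"
  shows "section_at G X \<phi> g (u @ v) = section_at G X \<phi> (section_at G X \<phi> g u) v"
proof -
  let ?h = "section_at G X \<phi> g u"
  obtain u' where u': "is_decomp G X \<phi> g u u' ?h"
    using is_decomp_section_at assms by blast
  obtain v' where v': "is_decomp G X \<phi> ?h v v' (section_at G X \<phi> ?h v)"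
    using is_decomp_section_at section_at_closed assms by blast
  have "is_decomp G X \<phi> g (u @ v) (u' @ v') (section_at G X \<phi> ?h v)"
    using u' v' assms(3) by (auto simp: is_decomp_def shift_streams)
  then show ?thesis by (rule section_at_eqI[OF assms(1)])
qed

lemma section_at_Cons:
  assumes "X \<noteq> {}" "x \<in> X" "u \<in> lists X" "g \<in> carrier G"
  shows "section_at G X \<phi> g (x # u) = section_at G X \<phi> (section_at G X \<phi> g [x]) u"
  using section_at_append[of "[x]" u g] assms by simp

lemma section_at_one:
  assumes "X \<noteq> {}" "u \<in> lists X"
  shows "section_at G X \<phi> \<one> u = \<one>"
proof -
  have "\<phi> \<one> w = w" if "w \<in> streams X" for w
    using id_eq_one that by (metis restrict_apply')
  then have "is_decomp G X \<phi> \<one> u u \<one>"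
    using assms(2) group.is_monoid[OF group_hom.axioms(1)[OF group_hom]]
    by (auto simp: is_decomp_def shift_streams monoid.one_closed)
  then show ?thesis by (rule section_at_eqI[OF assms(1)])
qed

end

section \<open>The Bernoulli measure\<close>

lemma stake_in_lists: "w \<in> streams X \<Longrightarrow> stake n w \<in> lists X"
  using snth_in by (fastforce simp: stake_nth in_set_conv_nth)

lemma space_bernoulli_measure: "space (bernoulli_measure X) = streams X"
  by (simp add: bernoulli_measure_def space_stream_space space_uniform_count_measure)

lemma prob_space_bernoulli_measure:
  assumes "finite X" "X \<noteq> {}"
  shows "prob_space (bernoulli_measure X)"
  unfolding bernoulli_measure_def
  by (rule prob_space.prob_space_stream_space[OF prob_space_uniform_count_measure[OF assms]])

text \<open>
  The type of letters may be uncountable, so measurability cannot be derived from countability of the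
  set of all lists. It is enough that the letters of a word in \<open>X\<^sup>\<omega>\<close> take finitely many values,
  each on a measurable set; this is used one letter at a time.
\<close>

lemma sets_stake_bernoulli_measure:
  assumes "finite X"
  shows "{w \<in> streams X. P (stake n w)} \<in> sets (bernoulli_measure X)"
proof (induction n arbitrary: P)
  case 0
  show ?case
    using sets.top[of "bernoulli_measure X"] by (auto simp: space_bernoulli_measure)
next
  case (Suc n)
  let ?U = "uniform_count_measure X"
  let ?M = "stream_space ?U"
  have sp: "space ?M = streams X" by (simp add: space_stream_space space_uniform_count_measure)
  have "{w \<in> streams X. P (stake (Suc n) w)} =
      (\<Union>x\<in>X. (shd -` {x} \<inter> space ?M) \<inter> (stl -` {w \<in> streams X. P (x # stake n w)} \<inter> space ?M))"
    by (auto simp: sp streams_shd streams_stl)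
  also have "\<dots> \<in> sets ?M"
  proof (intro sets.finite_UN[OF assms])
    fix x assume "x \<in> X"
    then have "shd -` {x} \<inter> space ?M \<in> sets ?M"
      by (intro measurable_sets[OF measurable_shd]) (simp add: sets_uniform_count_measure)
    moreover have "stl -` {w \<in> streams X. P (x # stake n w)} \<inter> space ?M \<in> sets ?M"
      using Suc.IH[of "\<lambda>u. P (x # u)"]
      by (intro measurable_sets[OF measurable_stl]) (simp add: bernoulli_measure_def)
    ultimately show "(shd -` {x} \<inter> space ?M) \<inter>
        (stl -` {w \<in> streams X. P (x # stake n w)} \<inter> space ?M) \<in> sets ?M"
      by (rule sets.Int)
  qed
  finally show ?case unfolding bernoulli_measure_def .
qed

lemma measure_bernoulli_first_letter:
  assumes "finite X" "X \<noteq> {}" and A: "A \<in> sets (bernoulli_measure X)"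
  shows "measure (bernoulli_measure X) A =
    (\<Sum>x\<in>X. measure (bernoulli_measure X) {w \<in> streams X. x ## w \<in> A}) / card X"
proof -
  let ?B = "bernoulli_measure X"
  interpret U: prob_space "uniform_count_measure X"
    by (rule prob_space_uniform_count_measure[OF assms(1,2)])
  interpret B: prob_space ?B
    by (rule prob_space_bernoulli_measure[OF assms(1,2)])
  have "emeasure ?B A =
      (\<integral>\<^sup>+ x. emeasure ?B {w \<in> streams X. x ## w \<in> A} \<partial>uniform_count_measure X)"
    using U.emeasure_stream_space[of A] A
    by (simp add: bernoulli_measure_def space_stream_space space_uniform_count_measure)
  also have "\<dots> = (\<Sum>x\<in>X. ennreal (1 / card X) * emeasure ?B {w \<in> streams X. x ## w \<in> A})"
    by (simp add: uniform_count_measure_def nn_integral_point_measure_finite assms(1))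
  also have "\<dots> = (\<Sum>x\<in>X. ennreal (measure ?B {w \<in> streams X. x ## w \<in> A} / card X))"
    by (simp add: B.emeasure_eq_measure flip: ennreal_mult)
  also have "\<dots> = ennreal (\<Sum>x\<in>X. measure ?B {w \<in> streams X. x ## w \<in> A} / card X)"
    by (rule sum_ennreal) simp
  finally show ?thesis
    by (simp add: B.emeasure_eq_measure sum_divide_distrib sum_nonneg)
qed

section \<open>The probability of reaching a trivial section\<close>

definition trivial_section_prob ::
  "('g, 'c) monoid_scheme \<Rightarrow> 'x set \<Rightarrow> ('g \<Rightarrow> 'x stream \<Rightarrow> 'x stream) \<Rightarrow> 'g \<Rightarrow> real" where
  "trivial_section_prob G X \<phi> g =
     measure (bernoulli_measure X) (\<Union>n. trivial_section_set G X \<phi> g n)"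

lemma sets_trivial_section_set:
  "finite X \<Longrightarrow> trivial_section_set G X \<phi> g n \<in> sets (bernoulli_measure X)"
  unfolding trivial_section_set_def by (rule sets_stake_bernoulli_measure)

context self_similar_action
begin

lemma trivial_section_prob_one:
  assumes "finite X" "X \<noteq> {}"
  shows "trivial_section_prob G X \<phi> \<one> = 1"
proof -
  interpret B: prob_space "bernoulli_measure X"
    by (rule prob_space_bernoulli_measure[OF assms])
  have "(\<Union>n. trivial_section_set G X \<phi> \<one> n) = space (bernoulli_measure X)"
    by (auto simp: trivial_section_set_def section_at_one assms(2) stake_in_lists
        space_bernoulli_measure)
  then show ?thesis by (simp add: trivial_section_prob_def B.prob_space)
qed

text \<open>
  On words that start with \<open>x\<close>, the sections of \<open>g\<close> are those of \<open>h(g, x)\<close> along the tail. The only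
  index that this shift by one letter loses is \<open>0\<close>; but if the section at the empty word, which is
  \<open>g\<close>, is trivial, then so is the section at \<open>x\<close>.
\<close>

lemma Stream_in_trivial_section_set_iff:
  assumes "X \<noteq> {}" "g \<in> carrier G" "x \<in> X" "w \<in> streams X"
  shows "x ## w \<in> (\<Union>n. trivial_section_set G X \<phi> g n) \<longleftrightarrow>
         w \<in> (\<Union>n. trivial_section_set G X \<phi> (section_at G X \<phi> g [x]) n)"
proof -
  let ?h = "section_at G X \<phi> g [x]"
  have Suc_iff: "x ## w \<in> trivial_section_set G X \<phi> g (Suc n) \<longleftrightarrow>
      w \<in> trivial_section_set G X \<phi> ?h n" for n
    using assms stake_in_lists[OF assms(4), of n]
    by (simp add: trivial_section_set_def streams_Stream section_at_Cons[of x "stake n w" g])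
  have "w \<in> trivial_section_set G X \<phi> ?h 0" if "x ## w \<in> trivial_section_set G X \<phi> g 0"
  proof -
    have "g = \<one>"
      using that assms(1,2) by (simp add: trivial_section_set_def section_at_Nil)
    then show ?thesis
      using assms by (simp add: trivial_section_set_def section_at_one)
  qed
  then have "x ## w \<in> trivial_section_set G X \<phi> g n \<Longrightarrow>
      \<exists>n. w \<in> trivial_section_set G X \<phi> ?h n" for n
    using Suc_iff by (cases n) auto
  then show ?thesis using Suc_iff by blast
qed

lemma trivial_section_prob_average:
  assumes "finite X" "X \<noteq> {}" "g \<in> carrier G"
  shows "trivial_section_prob G X \<phi> g =
    (\<Sum>x\<in>X. trivial_section_prob G X \<phi> (section_at G X \<phi> g [x])) / card X"
proof -
  have "{w \<in> streams X. x ## w \<in> (\<Union>n. trivial_section_set G X \<phi> g n)} =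
      (\<Union>n. trivial_section_set G X \<phi> (section_at G X \<phi> g [x]) n)" if "x \<in> X" for x
    using Stream_in_trivial_section_set_iff[OF assms(2,3) that] that
    by (auto simp: trivial_section_set_def)
  moreover have "(\<Union>n. trivial_section_set G X \<phi> g n) \<in> sets (bernoulli_measure X)"
    by (intro sets.countable_UN) (auto intro: sets_trivial_section_set assms(1))
  ultimately show ?thesis
    unfolding trivial_section_prob_def
    by (subst measure_bernoulli_first_letter[OF assms(1,2)]) auto
qed

text \<open>
  By iterated averaging, \<open>p(g)\<close> is the mean of \<open>p(h(g, v))\<close> over the words \<open>v\<close> of length \<open>n\<close>. This
  turns a bound on the nucleus, where all sections at long words lie, into a bound on the group.
\<close>

lemma trivial_section_prob_lower_bound:
  assumes "finite X" "X \<noteq> {}" "g \<in> carrier G"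
    and "\<And>v. v \<in> lists X \<Longrightarrow> length v = n \<Longrightarrow> m \<le> trivial_section_prob G X \<phi> (section_at G X \<phi> g v)"
  shows "m \<le> trivial_section_prob G X \<phi> g"
  using assms(3,4)
proof (induction n arbitrary: g)
  case 0
  then show ?case using section_at_Nil[OF assms(2)] by force
next
  case (Suc n)
  have "m \<le> trivial_section_prob G X \<phi> (section_at G X \<phi> g [x])" if "x \<in> X" for x
  proof (rule Suc.IH)
    show "section_at G X \<phi> g [x] \<in> carrier G"
      using section_at_closed assms(2) Suc.prems(1) that by simp
    fix v assume v: "v \<in> lists X" "length v = n"
    then show "m \<le> trivial_section_prob G X \<phi> (section_at G X \<phi> (section_at G X \<phi> g [x]) v)"
      using Suc.prems(2)[of "x # v"] that section_at_Cons[OF assms(2) that v(1) Suc.prems(1)]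
      by simp
  qed
  then have "card X * m \<le> (\<Sum>x\<in>X. trivial_section_prob G X \<phi> (section_at G X \<phi> g [x]))"
    using sum_bounded_below[of X m] by simp
  then show ?case
    using assms(1,2) trivial_section_prob_average[OF assms(1,2) Suc.prems(1)]
    by (simp add: pos_le_divide_eq card_gt_0_iff mult.commute)
qed

text \<open>
  If the average of numbers that are at least \<open>m\<close> equals \<open>m\<close>, then all of them equal \<open>m\<close>; this
  carries the minimum from an element to its sections, one letter at a time.
\<close>

lemma trivial_section_prob_minimum_spreads:
  assumes "finite X" "X \<noteq> {}"
    and m: "\<And>k. k \<in> carrier G \<Longrightarrow> m \<le> trivial_section_prob G X \<phi> k"
    and "g \<in> carrier G" "trivial_section_prob G X \<phi> g = m" "u \<in> lists X"
  shows "trivial_section_prob G X \<phi> (section_at G X \<phi> g u) = m"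
  using assms(6,4,5)
proof (induction u arbitrary: g rule: list.induct)
  case Nil
  then show ?case using section_at_Nil[OF assms(2)] by simp
next
  case (Cons x u)
  let ?p = "\<lambda>y. trivial_section_prob G X \<phi> (section_at G X \<phi> g [y])"
  have x: "x \<in> X" and u: "u \<in> lists X" using Cons.prems(1) by auto
  have closed: "section_at G X \<phi> g [y] \<in> carrier G" if "y \<in> X" for y
    using section_at_closed assms(2) Cons.prems(2) that by simp
  have "(\<Sum>y\<in>X. ?p y) = card X * m"
    using trivial_section_prob_average[OF assms(1,2) Cons.prems(2)] Cons.prems(3) assms(1,2)
    by (simp add: field_simps)
  then have "(\<Sum>y\<in>X. ?p y - m) = 0"
    by (simp add: sum_subtractf)
  then have "?p x = m"
    using sum_nonneg_eq_0_iff[OF assms(1), of "\<lambda>y. ?p y - m"] m closed x by simp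
  then have "trivial_section_prob G X \<phi> (section_at G X \<phi> (section_at G X \<phi> g [x]) u) = m"
    using Cons.IH[OF u closed[OF x]] by simp
  then show ?case
    using section_at_Cons[OF assms(2) x u Cons.prems(2)] by simp
qed

text \<open>
  Finiteness of \<open>N\<close> makes the minimum over \<open>N\<close> attained, absorption of long sections makes it the
  minimum over \<open>G\<close>, and the hypothesis on \<open>N\<close> leads from a minimizer to the unit, where \<open>p\<close> is \<open>1\<close>.
\<close>

lemma trivial_section_prob_eq_1:
  assumes "finite X" "X \<noteq> {}" and N: "contracting_set G X \<phi> N"
    and triv: "\<And>g. g \<in> N \<Longrightarrow> \<exists>u \<in> lists X. section_at G X \<phi> g u = \<one>"
    and "g \<in> carrier G"
  shows "trivial_section_prob G X \<phi> g = 1"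
proof -
  let ?p = "trivial_section_prob G X \<phi>"
  have N_fin: "finite N" and N_sub: "N \<subseteq> carrier G"
    using N by (auto simp: contracting_set_def)
  have absorb: "\<exists>n. \<forall>v \<in> lists X. length v = n \<longrightarrow> section_at G X \<phi> k v \<in> N"
    if "k \<in> carrier G" for k
    using N that unfolding contracting_set_def by (metis lessI)
  have "N \<noteq> {}"
  proof -
    obtain n where "\<forall>v \<in> lists X. length v = n \<longrightarrow> section_at G X \<phi> g v \<in> N"
      using absorb assms(5) by blast
    moreover obtain x where "x \<in> X" using assms(2) by blast
    then have "replicate n x \<in> lists X" by (auto simp: in_lists_conv_set)
    ultimately have "section_at G X \<phi> g (replicate n x) \<in> N" by simp
    then show ?thesis by blast
  qed
  define m where "m = Min (?p ` N)"
  have lower: "m \<le> ?p k" if k: "k \<in> carrier G" for k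
  proof -
    obtain n where "\<forall>v \<in> lists X. length v = n \<longrightarrow> section_at G X \<phi> k v \<in> N"
      using absorb k by blast
    then show ?thesis
      using trivial_section_prob_lower_bound[OF assms(1,2) k, of n m] N_fin by (simp add: m_def)
  qed
  have "m \<in> ?p ` N"
    unfolding m_def using N_fin \<open>N \<noteq> {}\<close> by (intro Min_in) auto
  then obtain g0 where g0: "g0 \<in> N" "?p g0 = m" by auto
  obtain u where u: "u \<in> lists X" "section_at G X \<phi> g0 u = \<one>"
    using triv g0(1) by blast
  have "?p \<one> = m"
    using trivial_section_prob_minimum_spreads[OF assms(1,2) lower _ g0(2) u(1)] g0(1) N_sub u(2)
    by auto
  then have "m = 1" using trivial_section_prob_one[OF assms(1,2)] by simp
  moreover have "?p g \<le> 1"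
    unfolding trivial_section_prob_def
    by (rule prob_space.prob_le_1[OF prob_space_bernoulli_measure[OF assms(1,2)]])
  ultimately show ?thesis using lower[OF assms(5)] by simp
qed

end

section \<open>Almost every word has a trivial section\<close>

theorem proposition4p4:
  fixes G :: "('g, 'c) monoid_scheme"
    and X :: "'x set"
    and \<phi> :: "'g \<Rightarrow> 'x stream \<Rightarrow> 'x stream"
  assumes "finite X" and "card X \<ge> 2"
    and "countable (carrier G)"
    and "self_similar_action G X \<phi>"
    and "contracting G X \<phi>"
    and "\<forall>g \<in> nucleus G X \<phi>. \<exists>u \<in> lists X. section_at G X \<phi> g u = \<one>\<^bsub>G\<^esub>"
  shows "\<forall>g \<in> carrier G.
           emeasure (bernoulli_measure X) (\<Union>n::nat. trivial_section_set G X \<phi> g n) = 1"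
proof
  fix g assume g: "g \<in> carrier G"
  have "X \<noteq> {}" using assms(2) by auto
  interpret B: prob_space "bernoulli_measure X"
    by (rule prob_space_bernoulli_measure[OF assms(1) \<open>X \<noteq> {}\<close>])
  have "trivial_section_prob G X \<phi> g = 1"
    using self_similar_action.trivial_section_prob_eq_1[OF assms(4,1) \<open>X \<noteq> {}\<close>
        nucleus_least(1)[OF assms(5)] _ g] assms(6) by blast
  then show "emeasure (bernoulli_measure X) (\<Union>n::nat. trivial_section_set G X \<phi> g n) = 1"
    by (simp add: trivial_section_prob_def B.emeasure_eq_measure)
qed

end
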